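(* Let $(A,\omega)$ be an anti-pre-Lie algebra. If $H^2(A;A)=0$, then $(A,\omega)$ is rigid, i.e. every $1$-parameter formal deformation of $(A,\omega)$ is trivial.
   Context: Let $\mathbb K$ be the ground field. An anti-pre-Lie algebra is a vector space (or $\mathbb K[[t]]$-module) $A$ with a bilinear product $\cdot$ such that for all $x,y,z$, with $[x,y]=x\cdot y-y\cdot x$: (1) $x\cdot(y\cdot z)-y\cdot(x\cdot z)=[y,x]\cdot z$; (2) $[x,y]\cdot z+[y,z]\cdot x+[z,x]\cdot y=0$. The product is also written $\omega(x,y)=x\cdot y$. A $1$-parameter formal deformation of $(A,\omega)$ is a $\mathbb K[[t]]$-bilinear map $\omega_t=\omega+\sum_{i\ge1}\omega_it^i:A[[t]]\otimes A[[t]]\to A[[t]]$, where each $\omega_i:A\otimes A\to A$ is linear (and $\omega_0=\omega$), i.e. $\omega_t(\sum_i a_it^i,\sum_j b_jt^j)=\sum_{i,j,k}\omega_k(a_i,b_j)t^{i+j+k}$, such that $(A[[t]],\omega_t)$ is an anti-pre-Lie algebra. It is trivial if there is a power series $\Phi_t=\sum_{i\ge0}\varphi_it^i$ with $\varphi_i:A\to A$ linear, $\varphi_0=\mathrm{Id}$, such that $\Phi_t\circ\omega_t=\omega\circ(\Phi_t\otimes\Phi_t)$ (with $\omega$ extended $\mathbb K[[t]]$-bilinearly to $A[[t]]$). Cohomology with coefficients in the regular representation $(A,L,R)$, $L_xy=x\cdot y$, $R_xy=y\cdot x$: $Z^2(A;A)$ is the space of linear maps $f:A\otimes A\to A$ such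 that for all $x,y,z\in A$, $x\cdot f(y,z)-y\cdot f(x,z)-f(y,x)\cdot z+f(x,y)\cdot z-f(y,x\cdot z)+f(x,y\cdot z)+f([x,y],z)=0$ and $(f(y,z)-f(z,y))\cdot x+(f(z,x)-f(x,z))\cdot y+(f(x,y)-f(y,x))\cdot z+f([x,y],z)+f([y,z],x)+f([z,x],y)=0$. $B^2(A;A)$ is the space of maps $\mathrm d^1\varphi(x,y)=x\cdot\varphi(y)+\varphi(x)\cdot y-\varphi(x\cdot y)$ with $\varphi:A\to A$ linear; $B^2(A;A)\subset Z^2(A;A)$ and $H^2(A;A)=Z^2(A;A)/B^2(A;A)$. *)

theory Defs
  imports Complex_Main "HOL-Computational_Algebra.Formal_Power_Series"
begin

unbundle fps_syntax

text \<open>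
  Linear maps out of \<open>A \<otimes> A\<close> are represented by bilinear maps on \<open>A\<close>. Over a field,
  \<open>module_hom\<close> is the same as \<open>Vector_Spaces.linear\<close>; it is used here because bilinearity is
  needed over the field and over its ring of formal power series.
\<close>

definition bilinear_map :: "('r::comm_ring_1 \<Rightarrow> 'a::ab_group_add \<Rightarrow> 'a) \<Rightarrow> ('a \<Rightarrow> 'a \<Rightarrow> 'a) \<Rightarrow> bool" where
  "bilinear_map scale f \<longleftrightarrow>
     (\<forall>x. module_hom scale scale (\<lambda>y. f x y)) \<and> (\<forall>y. module_hom scale scale (\<lambda>x. f x y))"

definition commutator :: "('a::ab_group_add \<Rightarrow> 'a \<Rightarrow> 'a) \<Rightarrow> 'a \<Rightarrow> 'a \<Rightarrow> 'a" where
  "commutator m x y = m x y - m y x"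

locale anti_pre_Lie_algebra = module scale
  for scale :: "'r::comm_ring_1 \<Rightarrow> 'a::ab_group_add \<Rightarrow> 'a" +
  fixes m :: "'a \<Rightarrow> 'a \<Rightarrow> 'a"
  assumes bilinear: "bilinear_map scale m"
    and left_identity: "m x (m y z) - m y (m x z) = m (commutator m y x) z"
    and cyclic_identity:
      "m (commutator m x y) z + m (commutator m y z) x + m (commutator m z x) y = 0"

subsection \<open>Second cohomology of the regular representation\<close>

definition Z2 :: "('k::field \<Rightarrow> 'a::ab_group_add \<Rightarrow> 'a) \<Rightarrow> ('a \<Rightarrow> 'a \<Rightarrow> 'a) \<Rightarrow> ('a \<Rightarrow> 'a \<Rightarrow> 'a) set" where
  "Z2 scale m = {f. bilinear_map scale f \<and>
     (\<forall>x y z. m x (f y z) - m y (f x z) - m (f y x) z + m (f x y) z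
              - f y (m x z) + f x (m y z) + f (commutator m x y) z = 0) \<and>
     (\<forall>x y z. m (f y z - f z y) x + m (f z x - f x z) y + m (f x y - f y x) z
              + f (commutator m x y) z + f (commutator m y z) x + f (commutator m z x) y = 0)}"

definition d1 :: "('a::ab_group_add \<Rightarrow> 'a \<Rightarrow> 'a) \<Rightarrow> ('a \<Rightarrow> 'a) \<Rightarrow> 'a \<Rightarrow> 'a \<Rightarrow> 'a" where
  "d1 m \<phi> x y = m x (\<phi> y) + m (\<phi> x) y - \<phi> (m x y)"

definition B2 :: "('k::field \<Rightarrow> 'a::ab_group_add \<Rightarrow> 'a) \<Rightarrow> ('a \<Rightarrow> 'a \<Rightarrow> 'a) \<Rightarrow> ('a \<Rightarrow> 'a \<Rightarrow> 'a) set" where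
  "B2 scale m = {d1 m \<phi> | \<phi>. module_hom scale scale \<phi>}"

definition cohomologous ::
    "('k::field \<Rightarrow> 'a::ab_group_add \<Rightarrow> 'a) \<Rightarrow> ('a \<Rightarrow> 'a \<Rightarrow> 'a) \<Rightarrow> (('a \<Rightarrow> 'a \<Rightarrow> 'a) \<times> ('a \<Rightarrow> 'a \<Rightarrow> 'a)) set" where
  "cohomologous scale m =
     {(f, g). f \<in> Z2 scale m \<and> g \<in> Z2 scale m \<and> (\<lambda>x y. f x y - g x y) \<in> B2 scale m}"

definition H2 :: "('k::field \<Rightarrow> 'a::ab_group_add \<Rightarrow> 'a) \<Rightarrow> ('a \<Rightarrow> 'a \<Rightarrow> 'a) \<Rightarrow> ('a \<Rightarrow> 'a \<Rightarrow> 'a) set set" where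
  "H2 scale m = Z2 scale m // cohomologous scale m"

definition H2_zero :: "('k::field \<Rightarrow> 'a::ab_group_add \<Rightarrow> 'a) \<Rightarrow> ('a \<Rightarrow> 'a \<Rightarrow> 'a) \<Rightarrow> ('a \<Rightarrow> 'a \<Rightarrow> 'a) set" where
  "H2_zero scale m = cohomologous scale m `` {\<lambda>x y. 0}"

subsection \<open>Formal deformations\<close>

text \<open>
  The type \<open>'a fps\<close> represents \<open>A[[t]]\<close> and \<open>'k fps\<close> represents \<open>K[[t]]\<close>; \<open>fps_scale scale\<close> is
  the action of the latter on the former.
\<close>

definition fps_scale :: "('k::field \<Rightarrow> 'a::ab_group_add \<Rightarrow> 'a) \<Rightarrow> 'k fps \<Rightarrow> 'a fps \<Rightarrow> 'a fps" where
  "fps_scale scale c a = Abs_fps (\<lambda>n. \<Sum>i\<le>n. scale (c $ i) (a $ (n - i)))"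

text \<open>
  The coefficient of \<open>t ^ n\<close> in \<open>\<Sum> w\<^sub>k(a\<^sub>i, b\<^sub>j) t ^ (i + j + k)\<close>; the nested sum runs over all
  triples with \<open>i + j + k = n\<close>.
\<close>

definition bilinear_series :: "(nat \<Rightarrow> 'a \<Rightarrow> 'a \<Rightarrow> 'a) \<Rightarrow> 'a fps \<Rightarrow> 'a fps \<Rightarrow> ('a::ab_group_add) fps" where
  "bilinear_series w a b =
     Abs_fps (\<lambda>n. \<Sum>k\<le>n. \<Sum>i\<le>n - k. w k (a $ i) (b $ (n - k - i)))"

definition linear_series :: "(nat \<Rightarrow> 'a \<Rightarrow> 'a) \<Rightarrow> 'a fps \<Rightarrow> ('a::ab_group_add) fps" where
  "linear_series \<phi> a = Abs_fps (\<lambda>n. \<Sum>i\<le>n. \<phi> i (a $ (n - i)))"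

text \<open>The \<open>K[[t]]\<close>-bilinear extension of a product on \<open>A\<close>, i.e. the series with constant term only.\<close>

definition bilinear_extension :: "('a \<Rightarrow> 'a \<Rightarrow> 'a) \<Rightarrow> 'a fps \<Rightarrow> 'a fps \<Rightarrow> ('a::ab_group_add) fps" where
  "bilinear_extension m = bilinear_series (\<lambda>k. if k = 0 then m else (\<lambda>x y. 0))"

definition formal_deformation ::
    "('k::field \<Rightarrow> 'a::ab_group_add \<Rightarrow> 'a) \<Rightarrow> ('a \<Rightarrow> 'a \<Rightarrow> 'a) \<Rightarrow> ('a fps \<Rightarrow> 'a fps \<Rightarrow> 'a fps) \<Rightarrow> bool" where
  "formal_deformation scale m mt \<longleftrightarrow>
     (\<exists>w. w 0 = m \<and> (\<forall>i. bilinear_map scale (w i)) \<and> mt = bilinear_series w) \<and>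
     anti_pre_Lie_algebra (fps_scale scale) mt"

definition trivial_deformation ::
    "('k::field \<Rightarrow> 'a::ab_group_add \<Rightarrow> 'a) \<Rightarrow> ('a \<Rightarrow> 'a \<Rightarrow> 'a) \<Rightarrow> ('a fps \<Rightarrow> 'a fps \<Rightarrow> 'a fps) \<Rightarrow> bool" where
  "trivial_deformation scale m mt \<longleftrightarrow>
     (\<exists>\<phi>. \<phi> 0 = id \<and> (\<forall>i. module_hom scale scale (\<phi> i)) \<and>
        (\<forall>a b. linear_series \<phi> (mt a b) =
               bilinear_extension m (linear_series \<phi> a) (linear_series \<phi> b)))"

definition rigid :: "('k::field \<Rightarrow> 'a::ab_group_add \<Rightarrow> 'a) \<Rightarrow> ('a \<Rightarrow> 'a \<Rightarrow> 'a) \<Rightarrow> bool" where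
  "rigid scale m \<longleftrightarrow>
     (\<forall>mt. formal_deformation scale m mt \<longrightarrow> trivial_deformation scale m mt)"

subsection \<open>Consistency of the definitions\<close>

lemma module_fps_scale:
  assumes "module scale"
  shows "module (fps_scale scale)"
proof -
  interpret module scale by fact
  show ?thesis
  proof
    fix a b :: "'a fps" and x y :: "'b fps"
    show "fps_scale scale a (x + y) = fps_scale scale a x + fps_scale scale a y"
      by (simp add: fps_scale_def fps_eq_iff scale_right_distrib sum.distrib)
    show "fps_scale scale (a + b) x = fps_scale scale a x + fps_scale scale b x"
      by (simp add: fps_scale_def fps_eq_iff scale_left_distrib sum.distrib)
    show "fps_scale scale a (fps_scale scale b x) = fps_scale scale (a * b) x"
    proof (rule fps_ext)
      fix n
      have "(\<Sum>j=0..n. \<Sum>i=0..j. scale (a $ i * b $ (j - i)) (x $ (n - j))) =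
            (\<Sum>j=0..n. \<Sum>i=0..n - j. scale (a $ j * b $ i) (x $ (n - j - i)))"
        by (rule fps_mult_assoc_lemma)
      then show "fps_scale scale a (fps_scale scale b x) $ n = fps_scale scale (a * b) x $ n"
        by (simp add: fps_scale_def fps_mult_nth atLeast0AtMost scale_sum_left scale_sum_right)
    qed
    show "fps_scale scale 1 x = x"
    proof (rule fps_ext)
      fix n
      have "fps_scale scale 1 x $ n = (\<Sum>i\<le>n. if i = 0 then x $ (n - i) else 0)"
        unfolding fps_scale_def fps_nth_Abs_fps by (rule sum.cong) auto
      also have "\<dots> = x $ n" by simp
      finally show "fps_scale scale 1 x $ n = x $ n" .
    qed
  qed
qed

lemma bilinear_extension_nth:
  "bilinear_extension m a b $ n = (\<Sum>i\<le>n. m (a $ i) (b $ (n - i)))"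
proof -
  have "bilinear_extension m a b $ n =
        (\<Sum>k\<le>n. if k = 0 then (\<Sum>i\<le>n - k. m (a $ i) (b $ (n - k - i))) else 0)"
    unfolding bilinear_extension_def bilinear_series_def fps_nth_Abs_fps
    by (rule sum.cong) auto
  then show ?thesis by simp
qed

lemma bilinear_mapD:
  assumes "bilinear_map scale f"
  shows "f x (y + z) = f x y + f x z" "f (x + y) z = f x z + f y z"
    and "f x (y - z) = f x y - f x z" "f (x - y) z = f x z - f y z"
    and "f x (scale c y) = scale c (f x y)" "f (scale c x) y = scale c (f x y)"
proof -
  interpret r: module_hom scale scale "\<lambda>y. f x y" for x
    using assms by (simp add: bilinear_map_def)
  interpret l: module_hom scale scale "\<lambda>x. f x y" for y
    using assms by (simp add: bilinear_map_def)
  show "f x (y + z) = f x y + f x z" by (rule r.add)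
  show "f (x + y) z = f x z + f y z" by (rule l.add)
  show "f x (y - z) = f x y - f x z" by (rule r.diff)
  show "f (x - y) z = f x z - f y z" by (rule l.diff)
  show "f x (scale c y) = scale c (f x y)" by (rule r.scale)
  show "f (scale c x) y = scale c (f x y)" by (rule l.scale)
qed

lemma B2_subset_Z2:
  assumes "anti_pre_Lie_algebra scale m"
  shows "B2 scale m \<subseteq> Z2 scale m"
proof
  interpret anti_pre_Lie_algebra scale m by fact
  note b = bilinear_mapD[OF bilinear]
  fix f assume "f \<in> B2 scale m"
  then obtain p where p: "module_hom scale scale p" and f: "f = d1 m p"
    by (auto simp: B2_def)
  interpret p: module_hom scale scale p by (rule p)
  define J where "J x y z = m x (m y z) - m y (m x z) - m (m y x - m x y) z" for x y z
  define C where "C x y z = m (m x y - m y x) z + m (m y z - m z y) x + m (m z x - m x z) y" for x y z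
  have J: "J x y z = 0" for x y z
    using left_identity[of x y z] by (simp add: J_def commutator_def)
  have C: "C x y z = 0" for x y z
    using cyclic_identity[of x y z] by (simp add: C_def commutator_def)
  have "bilinear_map scale f"
    unfolding bilinear_map_def f d1_def
    by (auto intro!: module_hom.intro module_axioms module_hom_axioms.intro
        simp: b p.add p.scale algebra_simps)
  moreover have "m x (f y z) - m y (f x z) - m (f y x) z + m (f x y) z
              - f y (m x z) + f x (m y z) + f (commutator m x y) z = 0" for x y z
  proof -
    have "?thesis \<longleftrightarrow> J x y (p z) + J x (p y) z + J (p x) y z - p (J x y z) = 0"
      by (simp add: J_def f d1_def commutator_def b p.add p.diff algebra_simps)
    then show ?thesis by (simp add: J p.zero)
  qed
  moreover have "m (f y z - f z y) x + m (f z x - f x z) y + m (f x y - f y x) z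
              + f (commutator m x y) z + f (commutator m y z) x + f (commutator m z x) y = 0" for x y z
  proof -
    have "?thesis \<longleftrightarrow> C x y (p z) + C x (p y) z + C (p x) y z - p (C x y z) = 0"
      by (simp add: C_def f d1_def commutator_def b p.add p.diff algebra_simps)
    then show ?thesis by (simp add: C p.zero)
  qed
  ultimately show "f \<in> Z2 scale m" by (simp add: Z2_def)
qed

lemma H2_zero_eq_B2:
  assumes "anti_pre_Lie_algebra scale m"
  shows "H2_zero scale m = B2 scale m"
proof -
  interpret anti_pre_Lie_algebra scale m by fact
  note b = bilinear_mapD[OF bilinear]
  have neg: "(\<lambda>x y. - f x y) \<in> B2 scale m" if fB: "f \<in> B2 scale m" for f
  proof -
    obtain p where p: "module_hom scale scale p" and f: "f = d1 m p"
      using fB by (auto simp: B2_def)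
    have "module_hom scale scale (\<lambda>x. - p x)"
      using p by (simp add: module_hom_iff)
    moreover have "(\<lambda>x y. - f x y) = d1 m (\<lambda>x. - p x)"
      using b(3)[of _ 0] b(4)[of 0] b(3)[of _ 0 0] b(4)[of 0 0]
      by (simp add: f d1_def fun_eq_iff)
    ultimately show ?thesis by (auto simp: B2_def)
  qed
  have "module_hom scale scale (\<lambda>x. 0)"
    by (simp add: module_hom_iff module_axioms)
  moreover have "(\<lambda>x y. 0) = d1 m (\<lambda>x. 0)"
    using b(3)[of _ 0 0] b(4)[of 0 0] by (simp add: d1_def fun_eq_iff)
  ultimately have "(\<lambda>x y. 0) \<in> B2 scale m" by (auto simp: B2_def)
  then show ?thesis
    using B2_subset_Z2[OF assms] neg
    by (fastforce simp: H2_zero_def cohomologous_def)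
qed

end

theory Submission
  imports Defs
begin

text \<open>
  The condition \<open>\<Phi> \<circ> \<omega>\<^sub>t = \<omega> \<circ> (\<Phi> \<otimes> \<Phi>)\<close> is solved one coefficient of \<open>\<Phi>\<close> at a time. The error
  \<open>E = \<Phi> \<circ> \<omega>\<^sub>t - \<omega> \<circ> (\<Phi> \<otimes> \<Phi>)\<close> is again a series of bilinear maps. If it vanishes below order
  \<open>n\<close>, applying \<open>\<Phi>\<close> to the two identities of \<open>\<omega>\<^sub>t\<close> and comparing coefficients of \<open>t ^ n\<close> with
  those of the same identities of \<open>\<omega>\<close> shows that the leading coefficient of \<open>E\<close> is a 2-cocycle.
  By hypothesis it equals \<open>d1 \<psi>\<close> for some linear \<open>\<psi>\<close>, and adding \<open>\<psi>\<close> to the coefficient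
  \<open>\<phi>\<^sub>n\<close> kills it without affecting lower orders. The product \<open>\<omega>\<^sub>t\<close> never has to be transported
  along the inverse of \<open>\<Phi>\<close>.
\<close>

section \<open>Reindexing of convolution sums\<close>

text \<open>A common form for the coefficients of both bracketings of three series, so that an
  identity of \<open>m\<close> can be applied inside a single sum.\<close>

definition triple_sum :: "(nat \<Rightarrow> nat \<Rightarrow> nat \<Rightarrow> 'a::comm_monoid_add) \<Rightarrow> nat \<Rightarrow> 'a" where
  "triple_sum f n = (\<Sum>i\<le>n. \<Sum>j\<le>n - i. f i j (n - i - j))"

lemma sum_nested_eq_triple_sum:
  "(\<Sum>s\<le>n. \<Sum>i\<le>s. f i (s - i) (n - s)) = triple_sum f n"
  unfolding triple_sum_def sum.Sigma[OF finite_atMost ballI[OF finite_atMost]]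
  by (rule sum.reindex_bij_witness
      [where i = "\<lambda>(i, j). (i + j, i)" and j = "\<lambda>(s, i). (i, s - i)"]) auto

lemma triple_sum_swap: "triple_sum f n = triple_sum (\<lambda>i j k. f j i k) n"
  unfolding triple_sum_def sum.Sigma[OF finite_atMost ballI[OF finite_atMost]]
  by (rule sum.reindex_bij_witness
      [where i = "\<lambda>(i, j). (j, i)" and j = "\<lambda>(i, j). (j, i)"])
    (auto simp: algebra_simps diff_right_commute)

lemma triple_sum_rotate: "triple_sum f n = triple_sum (\<lambda>i j k. f j k i) n"
  unfolding triple_sum_def sum.Sigma[OF finite_atMost ballI[OF finite_atMost]]
  by (rule sum.reindex_bij_witness
      [where i = "\<lambda>(i, j). (j, n - i - j)" and j = "\<lambda>(i, j). (n - i - j, i)"]) auto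

text \<open>Both sides run over quadruples of sum \<open>n\<close>. The left side groups them by the
  degree \<open>s\<close> of the first factor of a product of two series; the right side collects in
  \<open>k\<close> the first and third entries, which will be the degrees contributed by the two
  copies of \<open>\<phi>\<close>.\<close>

lemma quadruple_sum_regroup:
  fixes f :: "nat \<Rightarrow> nat \<Rightarrow> nat \<Rightarrow> nat \<Rightarrow> 'a::comm_monoid_add"
  shows "(\<Sum>s\<le>n. \<Sum>p\<le>s. \<Sum>q\<le>n - s. f p (s - p) q (n - s - q)) =
         (\<Sum>k\<le>n. \<Sum>i\<le>n - k. \<Sum>p\<le>k. f p i (k - p) (n - k - i))"
proof -
  have "(\<Sum>s\<le>n. \<Sum>p\<le>s. \<Sum>q\<le>n - s. f p (s - p) q (n - s - q)) =
        (\<Sum>(s, p, q)\<in>(SIGMA s:{..n}. SIGMA p:{..s}. {..n - s}). f p (s - p) q (n - s - q))"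
    by (simp add: sum.Sigma)
  also have "\<dots> = (\<Sum>(k, i, p)\<in>(SIGMA k:{..n}. SIGMA i:{..n - k}. {..k}). f p i (k - p) (n - k - i))"
    by (rule sum.reindex_bij_witness
        [where i = "\<lambda>(k, i, p). (p + i, p, k - p)" and j = "\<lambda>(s, p, q). (p + q, s - p, p)"])
      (auto simp: algebra_simps intro!: arg_cong[where f = "f _ _ _"])
  also have "\<dots> = (\<Sum>k\<le>n. \<Sum>i\<le>n - k. \<Sum>p\<le>k. f p i (k - p) (n - k - i))"
    by (simp add: sum.Sigma)
  finally show ?thesis .
qed

subsection \<open>Additivity\<close>

lemma module_hom_additive:
  assumes "module_hom scale scale f"
  shows "f (x - y) = f x - f y" "f (sum g I) = (\<Sum>i\<in>I. f (g i))"
proof -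
  interpret module_hom scale scale f by fact
  show "f (x - y) = f x - f y" by (rule diff)
  show "f (sum g I) = (\<Sum>i\<in>I. f (g i))" by (rule sum)
qed

lemma bilinear_map_additive:
  assumes "bilinear_map scale f"
  shows "f 0 y = 0" "f x 0 = 0"
    and "f (sum g I) y = (\<Sum>i\<in>I. f (g i) y)" "f x (sum g I) = (\<Sum>i\<in>I. f x (g i))"
proof -
  interpret r: module_hom scale scale "\<lambda>y. f x y" for x
    using assms by (simp add: bilinear_map_def)
  interpret l: module_hom scale scale "\<lambda>x. f x y" for y
    using assms by (simp add: bilinear_map_def)
  show "f 0 y = 0" "f x 0 = 0" by (rule l.zero r.zero)+
  show "f (sum g I) y = (\<Sum>i\<in>I. f (g i) y)" "f x (sum g I) = (\<Sum>i\<in>I. f x (g i))"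
    by (rule l.sum r.sum)+
qed

lemma linear_series_diff:
  assumes "\<And>i. module_hom scale scale (\<phi> i)"
  shows "linear_series \<phi> (a - b) = linear_series \<phi> a - linear_series \<phi> b"
  by (simp add: linear_series_def fps_eq_iff module_hom_additive(1)[OF assms] sum_subtractf)

lemma bilinear_extension_additive:
  assumes "bilinear_map scale m"
  shows "bilinear_extension m a (b + c) = bilinear_extension m a b + bilinear_extension m a c"
    and "bilinear_extension m (a + b) c = bilinear_extension m a c + bilinear_extension m b c"
    and "bilinear_extension m (a - b) c = bilinear_extension m a c - bilinear_extension m b c"
  by (simp_all add: fps_eq_iff bilinear_extension_nth bilinear_mapD[OF assms] sum.distrib sum_subtractf)

text \<open>In degree \<open>n\<close> the first nonzero map uses up the whole degree, so only the
  constant terms of the arguments are seen. This turns identities over A[[t]] into identities over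
  A.\<close>

lemma bilinear_series_leading:
  assumes "\<And>k x y. k < n \<Longrightarrow> e k x y = 0"
  shows "k < n \<Longrightarrow> bilinear_series e a b $ k = 0"
    and "bilinear_series e a b $ n = e n (a $ 0) (b $ 0)"
proof -
  show "bilinear_series e a b $ k = 0" if "k < n"
    using that by (simp add: bilinear_series_def assms)
  have "bilinear_series e a b $ n = (\<Sum>k\<le>n. if k = n then e n (a $ 0) (b $ 0) else 0)"
    unfolding bilinear_series_def fps_nth_Abs_fps
    by (rule sum.cong) (auto simp: assms)
  then show "bilinear_series e a b $ n = e n (a $ 0) (b $ 0)" by simp
qed

lemma bilinear_extension_leading:
  assumes "bilinear_map scale m" and "\<And>k. k < n \<Longrightarrow> b $ k = 0"
  shows "bilinear_extension m a b $ n = m (a $ 0) (b $ n)"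
    and "bilinear_extension m b a $ n = m (b $ n) (a $ 0)"
proof -
  have "bilinear_extension m a b $ n = (\<Sum>i\<le>n. if i = 0 then m (a $ 0) (b $ n) else 0)"
    unfolding bilinear_extension_nth
    by (rule sum.cong) (auto simp: assms(2) bilinear_map_additive[OF assms(1)])
  then show "bilinear_extension m a b $ n = m (a $ 0) (b $ n)" by simp
  have "bilinear_extension m b a $ n = (\<Sum>i\<le>n. if i = n then m (b $ n) (a $ 0) else 0)"
    unfolding bilinear_extension_nth
    by (rule sum.cong) (auto simp: assms(2) bilinear_map_additive[OF assms(1)])
  then show "bilinear_extension m b a $ n = m (b $ n) (a $ 0)" by simp
qed

subsection \<open>The power series extension of an anti-pre-Lie algebra\<close>

lemma bilinear_extension_right_nested:
  assumes "bilinear_map scale m"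
  shows "bilinear_extension m a (bilinear_extension m b c) $ n =
         triple_sum (\<lambda>i j k. m (a $ i) (m (b $ j) (c $ k))) n"
  by (simp add: bilinear_extension_nth triple_sum_def bilinear_map_additive[OF assms])

lemma bilinear_extension_left_nested:
  assumes "bilinear_map scale m"
  shows "bilinear_extension m (bilinear_extension m a b) c $ n =
         triple_sum (\<lambda>i j k. m (m (a $ i) (b $ j)) (c $ k)) n"
  by (simp add: bilinear_extension_nth bilinear_map_additive[OF assms]
      flip: sum_nested_eq_triple_sum)

context anti_pre_Lie_algebra
begin

text \<open>Needed for arbitrary series: the identities will be used at images under
  \<open>linear_series \<phi>\<close>, which need not be constant even when the arguments
  are.\<close>

lemma bilinear_extension_left_identity:
  fixes a b c :: "'a fps"
  defines "M \<equiv> bilinear_extension m"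
  shows "M a (M b c) - M b (M a c) = M (commutator M b a) c"
proof (rule fps_ext)
  fix n
  note add = bilinear_extension_additive[OF bilinear] bilinear_mapD[OF bilinear]
  note nested = bilinear_extension_right_nested[OF bilinear]
    bilinear_extension_left_nested[OF bilinear]
  have "(M a (M b c) - M b (M a c)) $ n =
      triple_sum (\<lambda>i j k. m (a $ i) (m (b $ j) (c $ k)) - m (b $ j) (m (a $ i) (c $ k))) n"
    unfolding M_def fps_sub_nth nested
    by (subst (2) triple_sum_swap) (simp add: triple_sum_def sum_subtractf)
  also have "\<dots> = triple_sum (\<lambda>i j k. m (m (b $ j) (a $ i)) (c $ k) - m (m (a $ i) (b $ j)) (c $ k)) n"
    by (simp add: left_identity commutator_def add)
  also have "\<dots> = M (commutator M b a) c $ n"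
    unfolding M_def commutator_def add fps_sub_nth nested
    by (subst (2) triple_sum_swap) (simp add: triple_sum_def sum_subtractf)
  finally show "(M a (M b c) - M b (M a c)) $ n = M (commutator M b a) c $ n" .
qed

lemma bilinear_extension_cyclic_identity:
  fixes a b c :: "'a fps"
  defines "M \<equiv> bilinear_extension m"
  shows "M (commutator M a b) c + M (commutator M b c) a + M (commutator M c a) b = 0"
proof (rule fps_ext)
  fix n
  note add = bilinear_extension_additive[OF bilinear] bilinear_mapD[OF bilinear]
  have comm: "M (commutator M a b) c $ n =
      triple_sum (\<lambda>i j k. m (commutator m (a $ i) (b $ j)) (c $ k)) n" for a b c
    unfolding M_def commutator_def add fps_sub_nth bilinear_extension_left_nested[OF bilinear]
    by (subst (2) triple_sum_swap) (simp add: triple_sum_def sum_subtractf)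
  \<comment> \<open>The indices are rotated until \<open>i\<close>, \<open>j\<close>,
    \<open>k\<close> belong to \<open>a\<close>, \<open>b\<close>, \<open>c\<close> in all three
    terms; then \<open>cyclic_identity\<close> applies to each summand.\<close>
  have 1: "M (commutator M b c) a $ n =
      triple_sum (\<lambda>i j k. m (commutator m (b $ j) (c $ k)) (a $ i)) n"
    unfolding comm by (rule triple_sum_rotate)
  have 2: "M (commutator M c a) b $ n =
      triple_sum (\<lambda>i j k. m (commutator m (c $ k) (a $ i)) (b $ j)) n"
    unfolding comm by (subst triple_sum_rotate, subst triple_sum_rotate) simp
  have "(M (commutator M a b) c + M (commutator M b c) a + M (commutator M c a) b) $ n =
    triple_sum (\<lambda>i j k. m (commutator m (a $ i) (b $ j)) (c $ k)
      + m (commutator m (b $ j) (c $ k)) (a $ i) + m (commutator m (c $ k) (a $ i)) (b $ j)) n"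
    unfolding fps_add_nth comm[of a b c] 1 2 by (simp add: triple_sum_def sum.distrib)
  also have "\<dots> = 0" by (simp add: cyclic_identity triple_sum_def)
  finally show "(M (commutator M a b) c + M (commutator M b c) a + M (commutator M c a) b) $ n
    = 0 $ n" by simp
qed

end

subsection \<open>The error of a formal equivalence\<close>

definition obstruction ::
    "('a \<Rightarrow> 'a \<Rightarrow> 'a) \<Rightarrow> (nat \<Rightarrow> 'a \<Rightarrow> 'a \<Rightarrow> 'a) \<Rightarrow> (nat \<Rightarrow> 'a \<Rightarrow> 'a) \<Rightarrow> nat \<Rightarrow> 'a \<Rightarrow> 'a \<Rightarrow> 'a::ab_group_add"
  where "obstruction m w \<phi> k x y =
    (\<Sum>i\<le>k. \<phi> i (w (k - i) x y)) - (\<Sum>i\<le>k. m (\<phi> i x) (\<phi> (k - i) y))"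

lemma linear_series_bilinear_series:
  assumes "\<And>i. module_hom scale scale (\<phi> i)"
  shows "linear_series \<phi> (bilinear_series w a b) =
         bilinear_series (\<lambda>k x y. \<Sum>i\<le>k. \<phi> i (w (k - i) x y)) a b"
proof (rule fps_ext)
  fix n
  define G where "G p k r = (\<Sum>i\<le>r. \<phi> p (w k (a $ i) (b $ (r - i))))" for p k r
  have "linear_series \<phi> (bilinear_series w a b) $ n = triple_sum G n"
    by (simp add: linear_series_def bilinear_series_def G_def triple_sum_def
        module_hom_additive(2)[OF assms] add.assoc)
  also have "\<dots> = (\<Sum>s\<le>n. \<Sum>i\<le>s. G i (s - i) (n - s))"
    by (rule sum_nested_eq_triple_sum[symmetric])
  also have "\<dots> = bilinear_series (\<lambda>k x y. \<Sum>i\<le>k. \<phi> i (w (k - i) x y)) a b $ n"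
    unfolding bilinear_series_def G_def fps_nth_Abs_fps by (intro sum.cong refl sum.swap)
  finally show "linear_series \<phi> (bilinear_series w a b) $ n =
    bilinear_series (\<lambda>k x y. \<Sum>i\<le>k. \<phi> i (w (k - i) x y)) a b $ n" .
qed

lemma bilinear_extension_linear_series:
  assumes "bilinear_map scale m"
  shows "bilinear_extension m (linear_series \<phi> a) (linear_series \<phi> b) =
         bilinear_series (\<lambda>k x y. \<Sum>i\<le>k. m (\<phi> i x) (\<phi> (k - i) y)) a b"
proof (rule fps_ext)
  fix n
  have "bilinear_extension m (linear_series \<phi> a) (linear_series \<phi> b) $ n =
      (\<Sum>s\<le>n. \<Sum>p\<le>s. \<Sum>q\<le>n - s. m (\<phi> p (a $ (s - p))) (\<phi> q (b $ (n - s - q))))"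
    unfolding bilinear_extension_nth linear_series_def fps_nth_Abs_fps
    by (simp only: bilinear_map_additive(3)[OF assms]) (simp only: bilinear_map_additive(4)[OF assms])
  also have "\<dots> = bilinear_series (\<lambda>k x y. \<Sum>i\<le>k. m (\<phi> i x) (\<phi> (k - i) y)) a b $ n"
    unfolding bilinear_series_def fps_nth_Abs_fps by (rule quadruple_sum_regroup)
  finally show "bilinear_extension m (linear_series \<phi> a) (linear_series \<phi> b) $ n =
    bilinear_series (\<lambda>k x y. \<Sum>i\<le>k. m (\<phi> i x) (\<phi> (k - i) y)) a b $ n" .
qed

lemma linear_series_obstruction:
  assumes "\<And>i. module_hom scale scale (\<phi> i)" and "bilinear_map scale m"
  shows "linear_series \<phi> (bilinear_series w a b) =
         bilinear_extension m (linear_series \<phi> a) (linear_series \<phi> b)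
         + bilinear_series (obstruction m w \<phi>) a b"
  unfolding linear_series_bilinear_series[OF assms(1)] bilinear_extension_linear_series[OF assms(2)]
  by (simp add: fps_eq_iff bilinear_series_def obstruction_def sum_subtractf)

lemma bilinear_map_obstruction:
  assumes "module scale" and \<phi>: "\<And>i. module_hom scale scale (\<phi> i)"
    and "bilinear_map scale m" and w: "\<And>i. bilinear_map scale (w i)"
  shows "bilinear_map scale (obstruction m w \<phi> n)"
proof -
  interpret module scale by fact
  note b = bilinear_mapD[OF assms(3)] bilinear_mapD[OF w]
  have p: "\<phi> i (x + y) = \<phi> i x + \<phi> i y" "\<phi> i (scale c x) = scale c (\<phi> i x)" for i x y c
    using \<phi> by (auto simp: module_hom_iff)
  show ?thesis
    unfolding bilinear_map_def obstruction_def
    by (auto intro!: module_hom.intro module_axioms module_hom_axioms.intro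
        simp: b p sum.distrib scale_sum_right algebra_simps)
qed

text \<open>Because \<open>\<phi> 0 = id\<close> and \<open>w 0 = m\<close>, the new
  \<open>\<psi>\<close> contributes \<open>\<psi> (m x y)\<close> to the first sum and the two end
  terms \<open>m (\<psi> x) y\<close> and \<open>m x (\<psi> y)\<close> to the second. For
  \<open>n > 0\<close> these ends are distinct, so no term is quadratic in
  \<open>\<psi>\<close>.\<close>

lemma obstruction_correct:
  assumes "bilinear_map scale m" "\<phi> 0 = id" "w 0 = m" "n > 0"
  shows "obstruction m w (\<phi>(n := \<lambda>x. \<phi> n x + \<psi> x)) n x y = obstruction m w \<phi> n x y - d1 m \<psi> x y"
proof -
  define \<phi>' where "\<phi>' = \<phi>(n := \<lambda>x. \<phi> n x + \<psi> x)"
  have "(\<Sum>i\<le>n. \<phi>' i (w (n - i) x y)) =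
        (\<Sum>i\<le>n. \<phi> i (w (n - i) x y) + (if i = n then \<psi> (m x y) else 0))"
    by (rule sum.cong) (auto simp: \<phi>'_def assms)
  also have "\<dots> = (\<Sum>i\<le>n. \<phi> i (w (n - i) x y)) + \<psi> (m x y)"
    by (simp add: sum.distrib)
  finally have 1: "(\<Sum>i\<le>n. \<phi>' i (w (n - i) x y)) = \<dots>" .
  have "(\<Sum>i\<le>n. m (\<phi>' i x) (\<phi>' (n - i) y)) =
        (\<Sum>i\<le>n. m (\<phi> i x) (\<phi> (n - i) y)
          + ((if i = n then m (\<psi> x) y else 0) + (if i = 0 then m x (\<psi> y) else 0)))"
    using assms(2,4) by (intro sum.cong) (auto simp: \<phi>'_def bilinear_mapD[OF assms(1)])
  also have "\<dots> = (\<Sum>i\<le>n. m (\<phi> i x) (\<phi> (n - i) y)) + (m (\<psi> x) y + m x (\<psi> y))"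
    by (simp add: sum.distrib)
  finally have 2: "(\<Sum>i\<le>n. m (\<phi>' i x) (\<phi>' (n - i) y)) = \<dots>" .
  show ?thesis
    unfolding obstruction_def \<phi>'_def[symmetric] 1 2 by (simp add: d1_def)
qed

text \<open>Locality in the degree: it protects the orders already solved when a later coefficient
  is changed, and lets the vanishing pass to the limit.\<close>

lemma obstruction_cong:
  assumes "\<And>i. i \<le> n \<Longrightarrow> \<phi> i = \<phi>' i"
  shows "obstruction m w \<phi> n = obstruction m w \<phi>' n"
  using assms by (simp add: obstruction_def fun_eq_iff)

text \<open>Expanding \<open>P (T a (T b c))\<close> by \<open>PT\<close> gives a pure
  \<open>M\<close> product of \<open>P\<close>-images, plus \<open>M (P a) (E b c)\<close> and
  \<open>E a (T b c)\<close>; the other bracketing behaves alike. The pure \<open>M\<close> products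
  cancel, and each remaining term contains a single \<open>E\<close>, so its coefficient at
  \<open>n\<close> involves only \<open>D\<close> and constant terms.\<close>

lemma leading_obstruction_in_Z2:
  fixes scale :: "'k::field \<Rightarrow> 'a::ab_group_add \<Rightarrow> 'a"
  assumes "anti_pre_Lie_algebra scale m"
    and def: "anti_pre_Lie_algebra (fps_scale scale) (bilinear_series w)"
    and w: "w 0 = m" "\<And>i. bilinear_map scale (w i)"
    and \<phi>: "\<phi> 0 = id" "\<And>i. module_hom scale scale (\<phi> i)"
    and low: "\<And>k x y. k < n \<Longrightarrow> obstruction m w \<phi> k x y = 0"
  shows "obstruction m w \<phi> n \<in> Z2 scale m"
proof -
  interpret anti_pre_Lie_algebra scale m by fact
  interpret t: anti_pre_Lie_algebra "fps_scale scale" "bilinear_series w" by fact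
  define D where "D = obstruction m w \<phi> n"
  define E where "E = bilinear_series (obstruction m w \<phi>)"
  define M where "M = bilinear_extension m"
  define T where "T = bilinear_series w"
  define P where "P = linear_series \<phi>"
  note M_add = bilinear_extension_additive[OF bilinear, folded M_def]
  have D: "bilinear_map scale D"
    unfolding D_def using module_axioms \<phi>(2) bilinear w(2) by (rule bilinear_map_obstruction)
  note D_add = bilinear_mapD[OF D]
  have PT: "P (T a b) = M (P a) (P b) + E a b" for a b
    unfolding P_def T_def M_def E_def by (rule linear_series_obstruction[OF \<phi>(2) bilinear])
  have P_diff: "P (a - b) = P a - P b" for a b
    unfolding P_def by (rule linear_series_diff[OF \<phi>(2)])
  have P_add: "P (a + b) = P a + P b" for a b
    using P_diff[of "a + b" b] by simp
  have P_0: "P 0 = 0" using P_diff[of 0 0] by simp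
  \<comment> \<open>In degree 0, \<open>P\<close> acts as the identity and \<open>T\<close> as
    \<open>m\<close>, which is why the cocycle conditions come out for the undeformed
    product.\<close>
  have P0: "P a $ 0 = a $ 0" for a by (simp add: P_def linear_series_def \<phi>)
  have T0: "T a b $ 0 = m (a $ 0) (b $ 0)" for a b by (simp add: T_def bilinear_series_def w)
  have E_low: "E a b $ k = 0" if "k < n" for a b k
    unfolding E_def by (rule bilinear_series_leading(1)[OF low that])
  have E_n: "E a b $ n = D (a $ 0) (b $ 0)" for a b
    unfolding E_def D_def by (rule bilinear_series_leading(2)[OF low])
  have ME: "M (P c) (E a b) $ n = m (c $ 0) (D (a $ 0) (b $ 0))"
    "M (E a b) (P c) $ n = m (D (a $ 0) (b $ 0)) (c $ 0)" for a b c
    unfolding M_def using bilinear_extension_leading[OF bilinear, of n "E a b" "P c"]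
    by (simp_all add: E_low E_n P0)
  have "m x (D y z) - m y (D x z) - m (D y x) z + m (D x y) z
      - D y (m x z) + D x (m y z) + D (commutator m x y) z = 0" for x y z
  proof -
    let ?x = "fps_const x" and ?y = "fps_const y" and ?z = "fps_const z"
    have "P (T ?x (T ?y ?z)) - P (T ?y (T ?x ?z)) = P (T (commutator T ?y ?x) ?z)"
      using t.left_identity[of ?x ?y ?z] by (simp add: T_def flip: P_diff)
    then have "(M (P ?x) (E ?y ?z) + E ?x (T ?y ?z) - M (P ?y) (E ?x ?z) - E ?y (T ?x ?z)) =
      M (E ?y ?x) (P ?z) - M (E ?x ?y) (P ?z) + E (commutator T ?y ?x) ?z"
      using bilinear_extension_left_identity[of "P ?x" "P ?y" "P ?z", folded M_def]
      by (simp add: PT P_diff M_add commutator_def algebra_simps)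
    then have "(M (P ?x) (E ?y ?z) + E ?x (T ?y ?z) - M (P ?y) (E ?x ?z) - E ?y (T ?x ?z)) $ n =
      (M (E ?y ?x) (P ?z) - M (E ?x ?y) (P ?z) + E (commutator T ?y ?x) ?z) $ n"
      by (rule arg_cong)
    then show ?thesis
      by (simp add: ME E_n T0 commutator_def D_add algebra_simps)
  qed
  moreover have "m (D y z - D z y) x + m (D z x - D x z) y + m (D x y - D y x) z
      + D (commutator m x y) z + D (commutator m y z) x + D (commutator m z x) y = 0" for x y z
  proof -
    let ?x = "fps_const x" and ?y = "fps_const y" and ?z = "fps_const z"
    define A where "A a b c = M (commutator M (P a) (P b)) (P c)" for a b c
    \<comment> \<open>\<open>A\<close> is the pure \<open>M\<close> part and \<open>B\<close> the
      part linear in \<open>E\<close>. The cyclic sums of \<open>A\<close> and of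
      \<open>A + B\<close> vanish, hence so does that of \<open>B\<close>.\<close>
    define B where "B a b c = M (E a b) (P c) - M (E b a) (P c) + E (commutator T a b) c" for a b c
    have PTT: "P (T (commutator T a b) c) = A a b c + B a b c" for a b c
      by (simp add: A_def B_def PT P_diff M_add commutator_def algebra_simps)
    have "P (T (commutator T ?x ?y) ?z) + P (T (commutator T ?y ?z) ?x)
        + P (T (commutator T ?z ?x) ?y) = 0"
      using t.cyclic_identity[of ?x ?y ?z] by (simp add: T_def P_0 flip: P_add)
    moreover have "A ?x ?y ?z + A ?y ?z ?x + A ?z ?x ?y = 0"
      unfolding A_def M_def by (rule bilinear_extension_cyclic_identity)
    moreover have "B ?x ?y ?z + B ?y ?z ?x + B ?z ?x ?y =
        (P (T (commutator T ?x ?y) ?z) + P (T (commutator T ?y ?z) ?x)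
          + P (T (commutator T ?z ?x) ?y)) - (A ?x ?y ?z + A ?y ?z ?x + A ?z ?x ?y)"
      by (simp add: PTT)
    ultimately have "(B ?x ?y ?z + B ?y ?z ?x + B ?z ?x ?y) $ n = 0"
      by simp
    then show ?thesis
      by (simp add: B_def ME E_n T0 commutator_def D_add bilinear_mapD[OF bilinear] algebra_simps)
  qed
  ultimately show ?thesis using D unfolding Z2_def D_def by blast
qed

section \<open>Vanishing cohomology and the construction of the equivalence\<close>

lemma Z2_subset_B2:
  fixes scale :: "'k::field \<Rightarrow> 'a::ab_group_add \<Rightarrow> 'a"
  assumes "anti_pre_Lie_algebra scale m" and "H2 scale m = {H2_zero scale m}"
  shows "Z2 scale m \<subseteq> B2 scale m"
proof
  interpret anti_pre_Lie_algebra scale m by fact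
  fix f assume f: "f \<in> Z2 scale m"
  have "module_hom scale scale (\<lambda>x. 0)"
    by (simp add: module_hom_iff module_axioms)
  moreover have "(\<lambda>x y. 0) = d1 m (\<lambda>x. 0)"
    by (simp add: d1_def fun_eq_iff bilinear_map_additive[OF bilinear])
  ultimately have "(\<lambda>x y. 0) \<in> B2 scale m" by (auto simp: B2_def)
  \<comment> \<open>Reflexivity at \<open>f\<close> amounts to the zero map being a coboundary. The
    class of \<open>f\<close> must be the only class there is, and that one consists of the
    coboundaries.\<close>
  then have "f \<in> cohomologous scale m `` {f}"
    using f by (simp add: cohomologous_def)
  moreover have "cohomologous scale m `` {f} = H2_zero scale m"
    using assms(2) quotientI[OF f, of "cohomologous scale m"] by (simp add: H2_def)
  ultimately show "f \<in> B2 scale m" by (simp add: H2_zero_eq_B2[OF assms(1)])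
qed

theorem theorem4p8:
  fixes scale :: "'k::field \<Rightarrow> 'a::ab_group_add \<Rightarrow> 'a"
    and \<omega> :: "'a \<Rightarrow> 'a \<Rightarrow> 'a"
  assumes "vector_space scale"
    and "anti_pre_Lie_algebra scale \<omega>"
    and "H2 scale \<omega> = {H2_zero scale \<omega>}"
  shows "rigid scale \<omega>"
  unfolding rigid_def
proof (intro allI impI)
  interpret anti_pre_Lie_algebra scale \<omega> by fact
  fix mt assume "formal_deformation scale \<omega> mt"
  then obtain w where w: "w 0 = \<omega>" "\<And>i. bilinear_map scale (w i)" and mt: "mt = bilinear_series w"
    and t: "anti_pre_Lie_algebra (fps_scale scale) (bilinear_series w)"
    by (auto simp: formal_deformation_def)
  define good where "good n \<phi> \<longleftrightarrow> \<phi> 0 = id \<and> (\<forall>i. module_hom scale scale (\<phi> i)) \<and>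
      (\<forall>k\<le>n. \<forall>x y. obstruction \<omega> w \<phi> k x y = 0)" for n \<phi>
  \<comment> \<open>Requiring consecutive approximations to agree through degree \<open>n\<close>
    makes every coefficient eventually constant.\<close>
  have "\<exists>F. \<forall>n. good n (F n) \<and> (\<forall>i\<le>n. F (Suc n) i = F n i)"
  proof (rule dependent_nat_choice)
    \<comment> \<open>The identity series starts the recursion: its error in degree 0 is
      \<open>w 0 - \<omega> = 0\<close>.\<close>
    have "module_hom scale scale (if i = 0 then id else (\<lambda>x. 0))" for i :: nat
      by (simp add: module_hom_iff module_axioms)
    then have "good 0 (\<lambda>i. if i = 0 then id else (\<lambda>x. 0))"
      by (simp add: good_def obstruction_def w)
    then show "\<exists>\<phi>. good 0 \<phi>" by blast
  next
    fix \<phi> n assume g: "good n \<phi>"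
    then have \<phi>: "\<phi> 0 = id" "\<And>i. module_hom scale scale (\<phi> i)"
      and low: "\<And>k x y. k < Suc n \<Longrightarrow> obstruction \<omega> w \<phi> k x y = 0"
      by (auto simp: good_def)
    have "obstruction \<omega> w \<phi> (Suc n) \<in> B2 scale \<omega>"
      using leading_obstruction_in_Z2[OF assms(2) t w \<phi> low] Z2_subset_B2[OF assms(2,3)] by blast
    then obtain \<psi> where \<psi>: "module_hom scale scale \<psi>" "obstruction \<omega> w \<phi> (Suc n) = d1 \<omega> \<psi>"
      by (auto simp: B2_def)
    define \<phi>' where "\<phi>' = \<phi>(Suc n := \<lambda>x. \<phi> (Suc n) x + \<psi> x)"
    have "module_hom scale scale (\<phi>' i)" for i
      using \<phi>(2)[of i] \<psi>(1) by (auto simp: \<phi>'_def module_hom_iff algebra_simps)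
    moreover have "obstruction \<omega> w \<phi>' k x y = 0" if "k \<le> Suc n" for k x y
    proof (cases "k = Suc n")
      case True
      then show ?thesis
        using obstruction_correct[where \<phi> = \<phi> and w = w and n = "Suc n", OF bilinear \<phi>(1) w(1)] \<psi>(2)
        by (simp add: \<phi>'_def)
    next
      case False
      then have "obstruction \<omega> w \<phi>' k = obstruction \<omega> w \<phi> k"
        using that by (intro obstruction_cong) (auto simp: \<phi>'_def)
      then show ?thesis using that False low by simp
    qed
    ultimately have "good (Suc n) \<phi>'" using \<phi>(1) by (simp add: good_def \<phi>'_def)
    then show "\<exists>\<phi>'. good (Suc n) \<phi>' \<and> (\<forall>i\<le>n. \<phi>' i = \<phi> i)"
      by (intro exI[of _ \<phi>']) (auto simp: \<phi>'_def)
  qed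
  then obtain F where good: "\<And>n. good n (F n)" and F: "\<And>n i. i \<le> n \<Longrightarrow> F (Suc n) i = F n i"
    by blast
  \<comment> \<open>The diagonal is the limit: it agrees with \<open>F n\<close> through degree
    \<open>n\<close>, which is all that the error in degree \<open>n\<close> depends on.\<close>
  define \<phi> where "\<phi> n = F n n" for n
  have stable: "F n i = \<phi> i" if "i \<le> n" for n i
    using that by (induction n rule: dec_induct) (simp_all add: \<phi>_def F)
  have \<phi>: "\<phi> 0 = id" "\<And>i. module_hom scale scale (\<phi> i)"
    using good by (auto simp: good_def \<phi>_def)
  have "obstruction \<omega> w \<phi> n x y = 0" for n x y
    using good[of n] obstruction_cong[of n \<phi> "F n" \<omega> w] by (simp add: stable good_def)
  then have "bilinear_series (obstruction \<omega> w \<phi>) a b = 0" for a b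
    by (simp add: bilinear_series_def fps_eq_iff)
  then have "linear_series \<phi> (mt a b) =
      bilinear_extension \<omega> (linear_series \<phi> a) (linear_series \<phi> b)" for a b
    unfolding mt using linear_series_obstruction[where w = w, OF \<phi>(2) bilinear] by simp
  then show "trivial_deformation scale \<omega> mt"
    unfolding trivial_deformation_def using \<phi> by blast
qed

end
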